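(* Let $p$ be a prime and let $w=(a_n)_{n=1}^\infty$ be an infinite word on the alphabet $\{0,1,\dots,p-1\}$. Suppose there is a sequence $(w_j)_{j=1}^\infty$ of finite words on this alphabet and a sequence $(\delta_j)_{j=1}^\infty$ of positive real numbers, each less than $1$, such that for every $j$ the word $w_jw_jw_j^{\delta_j}$ occurs as a subword in $w$, and $\lim_{j\to\infty}|w_j^{\delta_j}|=\infty$. Then the real number $w_p=\sum_{n=1}^\infty a_np^{-n}$ satisfies the $p$-adic Littlewood conjecture.
   Context: Words: subwords are blocks of consecutive letters; $|v|$ denotes the length of a word $v$; juxtaposition denotes concatenation. For a finite word $v$ and $\delta\in(0,1)$, $v^{\delta}$ denotes the prefix of $v$ of length $\lfloor \delta\cdot|v|\rfloor$ (this is not a power of $v$). A real number $x$ satisfies the $p$-adic Littlewood conjecture (pLC) if $\liminf_{q\to\infty} q\cdot|q|_p\cdot\|qx\|=0$, where $q$ runs over the positive integers, $|\cdot|_p$ is the $p$-adic absolute value and $\|\cdot\|$ is the distance to the nearest integer. *)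

theory Defs
  imports "HOL-Analysis.Analysis" "HOL-Computational_Algebra.Primes"
begin

text \<open>
  Letters are natural numbers. An infinite word is a function \<open>a :: nat \<Rightarrow> nat\<close> whose letters are
  \<open>a 1, a 2, \<dots>\<close>; the value \<open>a 0\<close> is junk and is never looked at. Finite words are lists.
\<close>

definition occurs_in :: "nat list \<Rightarrow> (nat \<Rightarrow> nat) \<Rightarrow> bool" where
  "occurs_in v a \<longleftrightarrow> (\<exists>k\<ge>1. \<forall>i<length v. a (k + i) = v ! i)"

definition frac_prefix :: "'a list \<Rightarrow> real \<Rightarrow> 'a list" where
  "frac_prefix v \<delta> = take (nat \<lfloor>\<delta> * real (length v)\<rfloor>) v"

definition padic_abs :: "nat \<Rightarrow> nat \<Rightarrow> real" where
  "padic_abs p q = (if q = 0 then 0 else 1 / real p ^ multiplicity p q)"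

definition dist_nearest_int :: "real \<Rightarrow> real" where
  "dist_nearest_int x = \<bar>x - of_int (round x)\<bar>"

text \<open>
  The lower limit is taken in the extended reals, as the library function \<open>liminf\<close> needs a
  complete lattice. It ignores the single index \<open>q = 0\<close>.
\<close>

definition padic_Littlewood :: "nat \<Rightarrow> real \<Rightarrow> bool" where
  "padic_Littlewood p x \<longleftrightarrow>
     liminf (\<lambda>q. ereal (real q * padic_abs p q * dist_nearest_int (real q * x))) = 0"

definition base_value :: "nat \<Rightarrow> (nat \<Rightarrow> nat) \<Rightarrow> real" where
  "base_value p a = (\<Sum>n. real (a (Suc n)) / real p ^ Suc n)"

end

theory Submission
  imports Defs
begin

text \<open>
  If \<open>w w w\<^sup>\<delta>\<close> occurs in the word after \<open>n\<close> letters, with \<open>l = |w|\<close> and \<open>m = |w\<^sup>\<delta>|\<close>, take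
  \<open>q = p^n (p^l - 1)\<close>. Modulo 1, \<open>q x\<close> is the difference of the tails of the expansion of \<open>x\<close> after
  \<open>n + l\<close> and after \<open>n\<close> letters. These tails share their first \<open>l + m\<close> digits, so
  \<open>\<parallel>q x\<parallel> \<le> p^-(l + m)\<close>, while \<open>q |q|\<^sub>p = p^l - 1\<close>; hence \<open>q |q|\<^sub>p \<parallel>q x\<parallel> \<le> p^-m\<close>.
\<close>

text \<open>The series is dominated termwise by the one whose digits are all \<open>p - 1\<close>, a
  geometric series with sum 1. That extreme expansion is allowed, so the upper bound 1 is not
  strict.\<close>

lemma digit_series_bound:
  fixes a :: "nat \<Rightarrow> nat"
  assumes "p \<ge> 2" and "\<And>n. n \<ge> 1 \<Longrightarrow> a n < p"
  shows "summable (\<lambda>n. real (a (Suc n)) / real p ^ Suc n)"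
    and "0 \<le> base_value p a" and "base_value p a \<le> 1"
proof -
  define g where "g = (\<lambda>n. real (p - 1) / real p * (1 / real p) ^ n)"
  have "(\<lambda>n. (1 / real p) ^ n) sums (1 / (1 - 1 / real p))"
    using assms(1) by (intro geometric_sums) auto
  then have "g sums (real (p - 1) / real p * (1 / (1 - 1 / real p)))"
    unfolding g_def by (rule sums_mult)
  moreover have "real (p - 1) / real p * (1 / (1 - 1 / real p)) = 1"
    using assms(1) by (simp add: of_nat_diff field_simps)
  ultimately have g: "g sums 1" by metis
  have le: "real (a (Suc n)) / real p ^ Suc n \<le> g n" for n
  proof -
    have "a (Suc n) \<le> p - 1" using assms(2)[of "Suc n"] by simp
    then have "real (a (Suc n)) / real p ^ Suc n \<le> real (p - 1) / real p ^ Suc n"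
      by (intro divide_right_mono) auto
    then show ?thesis by (simp add: g_def power_one_over)
  qed
  show s: "summable (\<lambda>n. real (a (Suc n)) / real p ^ Suc n)"
    by (rule summable_comparison_test'[OF sums_summable[OF g], of 0]) (use le in auto)
  show "0 \<le> base_value p a"
    unfolding base_value_def by (rule suminf_nonneg[OF s]) auto
  show "base_value p a \<le> 1"
    unfolding base_value_def using suminf_le[OF le s sums_summable[OF g]] sums_unique[OF g] by simp
qed

text \<open>Multiplying by \<open>p ^ n\<close> moves the radix point past \<open>n\<close> digits:
  these become an integer, and what is left is the value of the tail. So the tail represents
  \<open>p ^ n * base_value p a\<close> modulo 1.\<close>

lemma base_value_split:
  fixes a :: "nat \<Rightarrow> nat"
  assumes "p \<ge> 2" and "\<And>n. n \<ge> 1 \<Longrightarrow> a n < p"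
  shows "real p ^ n * base_value p a =
           of_nat (\<Sum>i<n. a (Suc i) * p ^ (n - Suc i)) + base_value p (\<lambda>i. a (n + i))"
proof -
  let ?f = "\<lambda>i. real (a (Suc i)) / real p ^ Suc i"
  have p: "real p \<noteq> 0" using assms(1) by simp
  have head: "real p ^ n * ?f i = real (a (Suc i) * p ^ (n - Suc i))" if "i < n" for i
  proof -
    have "real p ^ n = real p ^ (n - Suc i) * real p ^ Suc i"
      using that by (simp only: flip: power_add) simp
    then show ?thesis using p by simp
  qed
  have tail: "real p ^ n * ?f (i + n) = real (a (n + Suc i)) / real p ^ Suc i" for i
    using p by (simp add: power_add field_simps)
  have sf: "summable ?f" by (rule digit_series_bound(1)) (use assms in auto)
  have "real p ^ n * base_value p a = real p ^ n * (\<Sum>i. ?f (i + n)) + real p ^ n * (\<Sum>i<n. ?f i)"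
    unfolding base_value_def suminf_split_initial_segment[OF sf, of n] by (rule distrib_left)
  also have "real p ^ n * (\<Sum>i. ?f (i + n)) = (\<Sum>i. real p ^ n * ?f (i + n))"
    by (rule suminf_mult[symmetric]) (use sf in \<open>subst summable_iff_shift\<close>)
  also have "\<dots> = base_value p (\<lambda>i. a (n + i))"
    unfolding base_value_def tail ..
  also have "real p ^ n * (\<Sum>i<n. ?f i) = of_nat (\<Sum>i<n. a (Suc i) * p ^ (n - Suc i))"
    unfolding sum_distrib_left of_nat_sum by (rule sum.cong) (use head in auto)
  finally show ?thesis by simp
qed

text \<open>After scaling by \<open>p ^ n\<close> the two integer parts coincide and cancel, leaving
  the difference of two tails that both lie in [0, 1].\<close>

lemma base_value_common_prefix:
  fixes a b :: "nat \<Rightarrow> nat"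
  assumes "p \<ge> 2" and "\<And>n. n \<ge> 1 \<Longrightarrow> a n < p" and "\<And>n. n \<ge> 1 \<Longrightarrow> b n < p"
    and "\<And>i. i < n \<Longrightarrow> a (Suc i) = b (Suc i)"
  shows "real p ^ n * \<bar>base_value p a - base_value p b\<bar> \<le> 1"
proof -
  let ?A = "base_value p (\<lambda>i. a (n + i))" and ?B = "base_value p (\<lambda>i. b (n + i))"
  have "(\<Sum>i<n. a (Suc i) * p ^ (n - Suc i)) = (\<Sum>i<n. b (Suc i) * p ^ (n - Suc i))"
    using assms(4) by simp
  then have "real p ^ n * base_value p a - real p ^ n * base_value p b = ?A - ?B"
    using base_value_split[of p a n] base_value_split[of p b n] assms(1-3) by simp
  then have "real p ^ n * \<bar>base_value p a - base_value p b\<bar> = \<bar>?A - ?B\<bar>"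
    by (metis abs_mult abs_of_nonneg of_nat_0_le_iff right_diff_distrib zero_le_power)
  moreover have "0 \<le> ?A" "?A \<le> 1" "0 \<le> ?B" "?B \<le> 1"
    using assms(1-3) by (auto intro!: digit_series_bound(2,3))
  ultimately show ?thesis by linarith
qed

lemma dist_nearest_int_le: "dist_nearest_int x \<le> \<bar>x - of_int n\<bar>"
  unfolding dist_nearest_int_def using round_diff_minimal[of x n] by (simp add: abs_minus_commute)

text \<open>Since \<open>p ^ n * (p ^ l - 1) = p ^ (n + l) - p ^ n\<close>, the product is an
  integer plus the difference of two tails, which share their first \<open>L\<close> digits. The
  lemma is later applied with \<open>L\<close> equal to \<open>l + m\<close>.\<close>

lemma dist_nearest_int_diff_le:
  fixes a :: "nat \<Rightarrow> nat"
  assumes "p \<ge> 2" and "\<And>n. n \<ge> 1 \<Longrightarrow> a n < p"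
    and "\<And>i. i < L \<Longrightarrow> a (n + l + Suc i) = a (n + Suc i)"
  shows "real p ^ L * dist_nearest_int (real (p ^ n * (p ^ l - 1)) * base_value p a) \<le> 1"
proof -
  let ?T = "\<lambda>n. base_value p (\<lambda>i. a (n + i))"
  let ?N = "\<lambda>n. \<Sum>i<n. a (Suc i) * p ^ (n - Suc i)"
  let ?y = "real (p ^ n * (p ^ l - 1)) * base_value p a"
  have "?y = real p ^ (n + l) * base_value p a - real p ^ n * base_value p a"
    using assms(1) by (simp add: of_nat_diff power_add algebra_simps)
  also have "\<dots> = of_int (int (?N (n + l)) - int (?N n)) + (?T (n + l) - ?T n)"
    using base_value_split[of p a "n + l"] base_value_split[of p a n] assms(1,2) by simp
  finally have "dist_nearest_int ?y \<le> \<bar>?T (n + l) - ?T n\<bar>"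
    using dist_nearest_int_le[of ?y "int (?N (n + l)) - int (?N n)"] by simp
  then have "real p ^ L * dist_nearest_int ?y \<le> real p ^ L * \<bar>?T (n + l) - ?T n\<bar>"
    by (rule mult_left_mono) simp
  also have "\<dots> \<le> 1"
    by (rule base_value_common_prefix) (use assms in auto)
  finally show ?thesis .
qed

text \<open>As \<open>l \<ge> 1\<close>, the prime \<open>p\<close> does not divide
  \<open>p ^ l - 1\<close>, so the p-adic absolute value cancels exactly the factor
  \<open>p ^ n\<close>. The result does not depend on \<open>n\<close>, that is, on where the
  repetition occurs.\<close>

lemma padic_abs_power_mult_pred:
  assumes "prime p" and "l \<ge> 1"
  shows "real (p ^ n * (p ^ l - 1)) * padic_abs p (p ^ n * (p ^ l - 1)) = real (p ^ l - 1)"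
proof -
  have p: "p > 1" using assms(1) prime_gt_1_nat by blast
  have l: "p ^ l > 1" using p assms(2) by (intro one_less_power) auto
  have "\<not> p dvd p ^ l - 1"
  proof
    assume "p dvd p ^ l - 1"
    moreover have "p dvd p ^ l" using assms(2) by simp
    ultimately have "p dvd p ^ l - (p ^ l - 1)" by (rule dvd_diff_nat[rotated])
    with l p show False by simp
  qed
  then have "multiplicity p (p ^ n * (p ^ l - 1)) = n"
    using p by (intro multiplicity_eqI) (auto simp: dvd_mult_cancel_left)
  then show ?thesis
    using p l by (simp add: padic_abs_def)
qed

text \<open>The bound \<open>q \<ge> m\<close> is recorded because a lower limit needs arbitrarily
  large \<open>q\<close>, while the position of the occurrence may stay bounded.\<close>

lemma square_occurrence_approx:
  fixes a :: "nat \<Rightarrow> nat"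
  assumes "prime p" and "\<And>n. n \<ge> 1 \<Longrightarrow> a n < p" and "v \<noteq> []"
    and "occurs_in (v @ v @ take m v) a" and "m \<le> length v"
  obtains q where "q \<ge> m"
    and "real q * padic_abs p q * dist_nearest_int (real q * base_value p a) \<le> 1 / real p ^ m"
proof -
  let ?l = "length v"
  have p: "p \<ge> 2" using assms(1) prime_ge_2_nat by blast
  obtain k where k: "k \<ge> 1"
    and occ: "\<And>i. i < 2 * ?l + m \<Longrightarrow> a (k + i) = (v @ v @ take m v) ! i"
    using assms(4,5) unfolding occurs_in_def by (auto simp: algebra_simps mult_2)
  \<comment> \<open>Letters are numbered from 1, so an occurrence starting at \<open>k\<close> is
    preceded by \<open>k - 1\<close> letters.\<close>
  define n where "n = k - 1"
  define q where "q = p ^ n * (p ^ ?l - 1)"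
  have period: "a (n + ?l + Suc i) = a (n + Suc i)" if "i < ?l + m" for i
  proof -
    have "a (k + (?l + i)) = (v @ v @ take m v) ! (?l + i)"
      using that by (intro occ) simp
    \<comment> \<open>The word has period \<open>?l\<close>: a shift by \<open>?l\<close> leads from
      the first copy of \<open>v\<close> to the second, or from the first \<open>m\<close> letters
      of the second copy to the truncated third.\<close>
    also have "\<dots> = (v @ v @ take m v) ! i"
      using that assms(5) by (auto simp: nth_append)
    also have "\<dots> = a (k + i)"
      using that by (intro occ[symmetric]) simp
    finally show ?thesis using k by (simp add: n_def algebra_simps)
  qed
  have "real p ^ (?l + m) * dist_nearest_int (real q * base_value p a) \<le> 1"
    unfolding q_def using p assms(2) period by (rule dist_nearest_int_diff_le)
  then have d: "real p ^ ?l * dist_nearest_int (real q * base_value p a) \<le> 1 / real p ^ m"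
    using p by (simp add: power_add field_simps)
  have "real q * padic_abs p q = real (p ^ ?l - 1)"
    unfolding q_def using assms(1,3) by (intro padic_abs_power_mult_pred) (auto simp: Suc_le_eq)
  also have "\<dots> \<le> real p ^ ?l"
    by (metis diff_le_self of_nat_le_iff of_nat_power)
  finally have "real q * padic_abs p q * dist_nearest_int (real q * base_value p a)
      \<le> real p ^ ?l * dist_nearest_int (real q * base_value p a)"
    by (rule mult_right_mono) (simp add: dist_nearest_int_def)
  with d have "real q * padic_abs p q * dist_nearest_int (real q * base_value p a) \<le> 1 / real p ^ m"
    by linarith
  moreover have "q \<ge> m"
  proof -
    \<comment> \<open>The factor \<open>p ^ ?l - 1\<close> alone makes \<open>q\<close> large, even
      when \<open>n = 0\<close>.\<close>
    have "?l < 2 ^ ?l" by (rule less_exp)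
    also have "(2::nat) ^ ?l \<le> p ^ ?l" using p by (rule power_mono) simp
    finally have "m \<le> p ^ ?l - 1" using assms(5) by linarith
    also have "\<dots> \<le> q" using p by (simp add: q_def)
    finally show ?thesis .
  qed
  ultimately show thesis using that by blast
qed

text \<open>All terms are nonnegative, so the lower limit is at least 0; were it positive, some
  \<open>e > 0\<close> would lie below all late terms.\<close>

lemma padic_LittlewoodI:
  assumes "\<And>e N. e > 0 \<Longrightarrow>
    \<exists>q\<ge>N. real q * padic_abs p q * dist_nearest_int (real q * x) < e"
  shows "padic_Littlewood p x"
proof -
  let ?f = "\<lambda>q. ereal (real q * padic_abs p q * dist_nearest_int (real q * x))"
  have "0 \<le> liminf ?f"
    by (rule Liminf_bounded) (simp add: padic_abs_def dist_nearest_int_def)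
  moreover have "\<not> 0 < liminf ?f"
  proof
    assume "0 < liminf ?f"
    then obtain e where e: "0 < ereal e" "ereal e < liminf ?f"
      using ereal_dense2 by blast
    then obtain N where "\<And>q. q \<ge> N \<Longrightarrow> ereal e < ?f q"
      using less_LiminfD[OF e(2)] unfolding eventually_sequentially by blast
    then have "e < real q * padic_abs p q * dist_nearest_int (real q * x)" if "q \<ge> N" for q
      using that by simp
    with assms[of e N] e(1) show False by fastforce
  qed
  ultimately show ?thesis unfolding padic_Littlewood_def by simp
qed

theorem theorem2p1:
  fixes p :: nat and a :: "nat \<Rightarrow> nat" and w :: "nat \<Rightarrow> nat list" and \<delta> :: "nat \<Rightarrow> real"
  assumes "prime p"
    and "\<And>n. n \<ge> 1 \<Longrightarrow> a n \<in> {0..<p}"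
    and "\<And>j. j \<ge> 1 \<Longrightarrow> set (w j) \<subseteq> {0..<p}"
    and "\<And>j. j \<ge> 1 \<Longrightarrow> 0 < \<delta> j \<and> \<delta> j < 1"
    and "\<And>j. j \<ge> 1 \<Longrightarrow> occurs_in (w j @ w j @ frac_prefix (w j) (\<delta> j)) a"
    and "filterlim (\<lambda>j. length (frac_prefix (w j) (\<delta> j))) at_top sequentially"
  shows "padic_Littlewood p (base_value p a)"
proof (rule padic_LittlewoodI)
  fix e :: real and N :: nat
  assume "e > 0"
  have p: "p \<ge> 2" using assms(1) prime_ge_2_nat by blast
  then obtain M where M: "(1 / real p) ^ M < e"
    using real_arch_pow_inv[OF \<open>e > 0\<close>, of "1 / real p"] by auto
  \<comment> \<open>\<open>M\<close> makes the error smaller than \<open>e\<close>, \<open>N\<close>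
    makes \<open>q\<close> large enough, and the successor forces \<open>w j\<close> to be nonempty.
    The hypotheses on \<open>w\<close> and \<open>\<delta>\<close> start at index 1.\<close>
  have "eventually (\<lambda>j. length (frac_prefix (w j) (\<delta> j)) \<ge> max (Suc N) M \<and> j \<ge> 1) sequentially"
    using assms(6) unfolding filterlim_at_top by (intro eventually_conj eventually_ge_at_top) blast
  then obtain j where j: "j \<ge> 1" and len: "length (frac_prefix (w j) (\<delta> j)) \<ge> max (Suc N) M"
    by (auto dest: eventually_happens)
  define m where "m = length (frac_prefix (w j) (\<delta> j))"
  have pre: "frac_prefix (w j) (\<delta> j) = take m (w j)" and m: "m \<le> length (w j)"
    unfolding m_def frac_prefix_def by (auto simp: min_def)
  have "w j \<noteq> []" using len m unfolding m_def by auto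
  moreover have "a n < p" if "n \<ge> 1" for n using assms(2)[OF that] by simp
  moreover have "occurs_in (w j @ w j @ take m (w j)) a"
    using assms(5)[OF j] pre by simp
  ultimately obtain q where q: "q \<ge> m"
    "real q * padic_abs p q * dist_nearest_int (real q * base_value p a) \<le> 1 / real p ^ m"
    using square_occurrence_approx[of p a "w j" m] assms(1) m by blast
  have "1 / real p ^ m \<le> (1 / real p) ^ M"
    using p len by (auto simp: m_def power_one_over intro!: divide_left_mono power_increasing)
  with q M have "real q * padic_abs p q * dist_nearest_int (real q * base_value p a) < e"
    by linarith
  moreover have "q \<ge> N" using q(1) len unfolding m_def by simp
  ultimately show "\<exists>q\<ge>N. real q * padic_abs p q * dist_nearest_int (real q * base_value p a) < e"
    by blast
qed

end
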